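(* Let $G$ be a finite group of order $v$ (written additively, not necessarily abelian) and let $A$ be a non-trivial group of automorphisms of $G$ of order $k$ such that $(G,A)$ is a Ferrero pair. Then the set of $A$-orbits on $G\setminus\{0\}$ is a disjoint $(v,k,k-1)$ difference family in $G$. If moreover $G$ is abelian and $vk$ is odd, this difference family can be partitioned into two disjoint $(v,k,\frac{k-1}{2})$ difference families.
   Context: Groups are finite and written additively but not necessarily abelian. For a subset $B$ of a group $G$, the list of differences $\Delta B$ is the multiset of all differences $b-b'$ with $b,b'\in B$, $b\neq b'$. A collection $\mathcal F$ of subsets of $G$ is a difference family of index $\lambda$ if the multiset union $\biguplus_{B\in\mathcal F}\Delta B$ covers every non-zero element of $G$ exactly $\lambda$ times; it is a $(v,k,\lambda)$ difference family if $|G|=v$ and all members (blocks) have size $k$. It is disjoint (a DDF) if its blocks are pairwise disjoint. A Ferrero pair is a pair $(G,A)$ where $A$ is a non-trivial group of automorphisms of $G$ acting semiregularly on $G\setminus\{0\}$, i.e. for $g\in G$ and $\alpha\in A$, $\alpha(g)=g$ holds only if $\alpha=\mathrm{id}_G$ or $g=0$. *)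

theory Defs
  imports
    "HOL-Library.Multiset"
    "HOL-Library.Disjoint_Sets"
    "HOL-Algebra.Group_Action"
begin

text \<open>
  The groups of HOL-Algebra are written multiplicatively: the additive \<open>b - b'\<close> is
  \<open>b \<otimes> inv b'\<close> and the zero element is \<open>\<one>\<close>. No commutativity is assumed. Groups are understood
  to be finite; for infinite \<open>B\<close> the multiset below would be empty.
\<close>

definition differences :: "('a, 'b) monoid_scheme \<Rightarrow> 'a set \<Rightarrow> 'a multiset" where
  "differences G B =
     image_mset (\<lambda>(b, b'). b \<otimes>\<^bsub>G\<^esub> inv\<^bsub>G\<^esub> b') (mset_set {(b, b'). b \<in> B \<and> b' \<in> B \<and> b \<noteq> b'})"

definition difference_family :: "('a, 'b) monoid_scheme \<Rightarrow> nat \<Rightarrow> 'a set set \<Rightarrow> bool" where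
  "difference_family G l F \<longleftrightarrow>
     F \<subseteq> Pow (carrier G) \<and>
     (\<forall>g \<in> carrier G - {\<one>\<^bsub>G\<^esub>}. count (\<Sum>B\<in>F. differences G B) g = l)"

definition vkl_difference_family ::
  "('a, 'b) monoid_scheme \<Rightarrow> nat \<Rightarrow> nat \<Rightarrow> nat \<Rightarrow> 'a set set \<Rightarrow> bool" where
  "vkl_difference_family G v k l F \<longleftrightarrow>
     difference_family G l F \<and> order G = v \<and> (\<forall>B \<in> F. card B = k)"

definition disjoint_vkl_difference_family ::
  "('a, 'b) monoid_scheme \<Rightarrow> nat \<Rightarrow> nat \<Rightarrow> nat \<Rightarrow> 'a set set \<Rightarrow> bool" where
  "disjoint_vkl_difference_family G v k l F \<longleftrightarrow> vkl_difference_family G v k l F \<and> disjoint F"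

text \<open>Elements of \<open>AutoGroup G\<close> are extensional functions on \<open>carrier G\<close>; its unit is the
  identity restricted to \<open>carrier G\<close>.\<close>

definition ferrero_pair :: "('a, 'b) monoid_scheme \<Rightarrow> ('a \<Rightarrow> 'a) set \<Rightarrow> bool" where
  "ferrero_pair G A \<longleftrightarrow>
     subgroup A (AutoGroup G) \<and>
     A \<noteq> {\<one>\<^bsub>AutoGroup G\<^esub>} \<and>
     (\<forall>\<alpha> \<in> A. \<forall>g \<in> carrier G. \<alpha> g = g \<longrightarrow> \<alpha> = \<one>\<^bsub>AutoGroup G\<^esub> \<or> g = \<one>\<^bsub>G\<^esub>)"

definition nonzero_orbits :: "('a, 'b) monoid_scheme \<Rightarrow> ('a \<Rightarrow> 'a) set \<Rightarrow> 'a set set" where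
  "nonzero_orbits G A =
     orbits (AutoGroup G\<lparr>carrier := A\<rparr>) (carrier G - {\<one>\<^bsub>G\<^esub>}) (\<lambda>\<alpha>. \<alpha>)"

end

theory Submission
  imports Defs "HOL-Algebra.Multiplicative_Group"
begin

text \<open>
  For a non-identity \<open>\<alpha> \<in> A\<close> the map sending \<open>x\<close> to \<open>\<alpha>(x) - x\<close> is injective by semiregularity,
  hence permutes \<open>G - {0}\<close>. The differences inside the orbit of \<open>x\<close> with subtrahend \<open>x\<close> are the
  \<open>\<alpha>(x) - x\<close> with \<open>\<alpha> \<noteq> id\<close>, so summing over all \<open>x\<close> first yields one copy of \<open>G - {0}\<close> for each of
  the \<open>k - 1\<close> non-identity \<open>\<alpha>\<close>.

  If \<open>v k\<close> is odd, then \<open>-B\<close> is an orbit different from \<open>B\<close> for every orbit \<open>B\<close>: from \<open>\<alpha>(x) = -x\<close>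
  with \<open>x \<noteq> 0\<close> one gets \<open>\<alpha>\<^sup>2 = id\<close> by semiregularity, so \<open>\<alpha> = id\<close>, \<open>2x = 0\<close> and \<open>x = 0\<close>. If \<open>G\<close> is
  abelian, \<open>B\<close> and \<open>-B\<close> have the same list of differences. Putting one orbit of each pair
  \<open>{B, -B}\<close> into the first family and the other into the second one halves the index.
\<close>

lemma fixpoint_free_involution_split:
  assumes closed: "\<And>x. x \<in> X \<Longrightarrow> h x \<in> X"
    and invol: "\<And>x. x \<in> X \<Longrightarrow> h (h x) = x"
    and no_fixed_point: "\<And>x. x \<in> X \<Longrightarrow> h x \<noteq> x"
  obtains Y where "Y \<union> h ` Y = X" "Y \<inter> h ` Y = {}"
proof
  define pick where "pick S = (SOME y. y \<in> S)" for S :: "'a set"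
  define Y where "Y = {x \<in> X. pick {x, h x} = x}"
  have "pick {x, h x} \<in> {x, h x}" for x
    unfolding pick_def by (rule someI_ex) blast
  then have exactly_one: "h x \<in> Y \<longleftrightarrow> x \<notin> Y" if "x \<in> X" for x
    using closed[OF that] invol[OF that] no_fixed_point[OF that] that
    by (auto simp: Y_def insert_commute[of "h x" x])
  show "Y \<union> h ` Y = X"
  proof
    show "Y \<union> h ` Y \<subseteq> X"
      using closed by (auto simp: Y_def)
    show "X \<subseteq> Y \<union> h ` Y"
      using exactly_one invol by (metis UnCI image_eqI subsetI)
  qed
  show "Y \<inter> h ` Y = {}"
    using exactly_one by (auto simp: Y_def)
qed

lemma (in group) pow_eq_one_coprime_order:
  assumes "x \<in> carrier G" "x [^] (n::nat) = \<one>" "coprime n (order G)"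
  shows "x = \<one>"
proof -
  have "ord x dvd n" "ord x dvd order G"
    using assms pow_eq_id ord_dvd_group_order by auto
  then have "ord x = 1"
    using assms(3) coprime_common_divisor_nat by blast
  then show ?thesis
    using ord_eq_1[OF assms(1)] by simp
qed

corollary (in group) square_eq_one_odd_order:
  assumes "x \<in> carrier G" "x \<otimes> x = \<one>" "odd (order G)"
  shows "x = \<one>"
proof (rule pow_eq_one_coprime_order)
  show "x [^] (2::nat) = \<one>"
    using assms(1,2) by (simp add: numeral_2_eq_2)
  show "coprime 2 (order G)"
    using assms(3) by simp
qed (rule assms(1))

lemma (in group) bij_betw_displacement:
  assumes fin: "finite (carrier G)" and hom: "\<alpha> \<in> hom G G"
    and fixed_point_free: "\<And>x. \<lbrakk>x \<in> carrier G; \<alpha> x = x\<rbrakk> \<Longrightarrow> x = \<one>"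
  shows "bij_betw (\<lambda>x. \<alpha> x \<otimes> inv x) (carrier G - {\<one>}) (carrier G - {\<one>})"
proof -
  interpret \<alpha>: group_hom G G \<alpha>
    using hom by unfold_locales
  have "inj_on (\<lambda>x. \<alpha> x \<otimes> inv x) (carrier G)"
  proof (rule inj_onI)
    fix x y
    assume x: "x \<in> carrier G" and y: "y \<in> carrier G"
      and eq: "\<alpha> x \<otimes> inv x = \<alpha> y \<otimes> inv y"
    have "\<alpha> x = \<alpha> y \<otimes> inv y \<otimes> x"
      using inv_solve_right'[of "\<alpha> y \<otimes> inv y" "\<alpha> x" x] x y eq by simp
    then have "\<alpha> (inv y \<otimes> x) = inv y \<otimes> x"
      using x y by (simp add: m_assoc[symmetric])
    then have "inv y \<otimes> x = \<one>"
      using fixed_point_free x y by simp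
    then show "x = y"
      using x y by (metis inv_equality inv_inv inv_closed)
  qed
  then have "inj_on (\<lambda>x. \<alpha> x \<otimes> inv x) (carrier G - {\<one>})"
    by (rule inj_on_subset) blast
  moreover have "\<alpha> x \<otimes> inv x \<noteq> \<one>" if "x \<in> carrier G - {\<one>}" for x
    using that fixed_point_free inv_equality[of "\<alpha> x" "inv x"] by auto
  then have "(\<lambda>x. \<alpha> x \<otimes> inv x) ` (carrier G - {\<one>}) \<subseteq> carrier G - {\<one>}"
    by auto
  ultimately show ?thesis
    using fin by (simp add: bij_betw_def endo_inj_surj)
qed

lemma group_action_BijGroup: "group_action (BijGroup E) E (\<lambda>f. f)"
  by (simp add: group_action_def group_hom_def group_hom_axioms_def group_BijGroup hom_def)

lemma (in group) group_action_subgroup_AutoGroup: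
  assumes "subgroup A (AutoGroup G)"
  shows "group_action (AutoGroup G\<lparr>carrier := A\<rparr>) (carrier G) (\<lambda>\<alpha>. \<alpha>)"
proof -
  have "subgroup A (BijGroup (carrier G))"
    using group.incl_subgroup[OF group_BijGroup subgroup_auto] assms
    by (simp add: AutoGroup_def)
  then show ?thesis
    using group_action.induced_action[OF group_action_BijGroup] by (simp add: AutoGroup_def)
qed

lemma orbit_eq_image: "orbit G \<phi> x = (\<lambda>g. \<phi> g x) ` carrier G"
  by (auto simp: orbit_def)

lemma (in group_action) partition_orbits_invariant_subset:
  assumes "X \<subseteq> E" "\<And>x. x \<in> X \<Longrightarrow> orbit G \<phi> x \<subseteq> X"
  shows "partition X (orbits G X \<phi>)"
proof (rule partitionI)
  show "\<Union> (orbits G X \<phi>) = X"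
    using assms orbit_refl by (fastforce simp: orbits_def)
  have "orbits G X \<phi> \<subseteq> orbits G E \<phi>"
    using assms(1) by (auto simp: orbits_def)
  then show "B = C" if "B \<in> orbits G X \<phi>" "C \<in> orbits G X \<phi>" "B \<inter> C \<noteq> {}" for B C
    using that disjoint_union by blast
qed

lemma (in group_action) bij_betw_orbit_trivial_stabilizer:
  assumes x: "x \<in> E" and trivial: "stabilizer G \<phi> x = {\<one>}"
  shows "bij_betw (\<lambda>g. \<phi> g x) (carrier G) (orbit G \<phi> x)"
proof (rule bij_betw_imageI)
  interpret group G
    using group_hom by (rule group_hom.axioms)
  show "inj_on (\<lambda>g. \<phi> g x) (carrier G)"
  proof (rule inj_onI)
    fix g h assume g: "g \<in> carrier G" and h: "h \<in> carrier G" and eq: "\<phi> g x = \<phi> h x"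
    have "\<phi> (inv h \<otimes> g) x = x"
      using composition_rule[OF x, of "inv h" g] orbit_sym_aux[OF h x] g h eq by simp
    then have "inv h \<otimes> g = \<one>"
      using trivial g h by (auto simp: stabilizer_def)
    then show "g = h"
      using g h by (metis inv_equality inv_inv inv_closed)
  qed
qed (simp add: orbit_eq_image)

lemma differences_eq_sum:
  assumes "finite B"
  shows "differences G B = (\<Sum>x\<in>B. \<Sum>b\<in>B - {x}. {#b \<otimes>\<^bsub>G\<^esub> inv\<^bsub>G\<^esub> x#})"
proof -
  let ?P = "{(b, x). b \<in> B \<and> x \<in> B \<and> b \<noteq> x}"
  have "differences G B = (\<Sum>(b, x)\<in>?P. {#b \<otimes>\<^bsub>G\<^esub> inv\<^bsub>G\<^esub> x#})"
    by (simp add: differences_def sum_unfold_sum_mset case_prod_unfold)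
  also have "\<dots> = (\<Sum>(x, b)\<in>Sigma B (\<lambda>x. B - {x}). {#b \<otimes>\<^bsub>G\<^esub> inv\<^bsub>G\<^esub> x#})"
    by (rule sum.reindex_bij_witness[of _ prod.swap prod.swap]) auto
  also have "\<dots> = (\<Sum>x\<in>B. \<Sum>b\<in>B - {x}. {#b \<otimes>\<^bsub>G\<^esub> inv\<^bsub>G\<^esub> x#})"
    using assms by (simp add: sum.Sigma)
  finally show ?thesis .
qed

lemma (in comm_group) differences_inv_image:
  assumes "B \<subseteq> carrier G"
  shows "differences G (m_inv G ` B) = differences G B"
proof -
  let ?P = "\<lambda>B. {(b, b'). b \<in> B \<and> b' \<in> B \<and> b \<noteq> b'}"
  let ?swap_inv = "\<lambda>(b, b'). (inv b', inv b)"
  have inj: "inj_on (m_inv G) B"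
    using inv_inj assms by (rule inj_on_subset)
  have inj_swap_inv: "inj_on ?swap_inv (?P B)"
    using assms by (auto intro!: inj_onI dest: inj_onD[OF inj])
  have "?P (m_inv G ` B) = ?swap_inv ` ?P B"
    using inj assms by (auto simp: inj_on_eq_iff image_iff)
  then have "mset_set (?P (m_inv G ` B)) = image_mset ?swap_inv (mset_set (?P B))"
    by (simp only: image_mset_mset_set[OF inj_swap_inv])
  then have "differences G (m_inv G ` B)
      = image_mset (\<lambda>(b, b'). inv b' \<otimes> inv (inv b)) (mset_set (?P B))"
    by (simp add: differences_def multiset.map_comp o_def case_prod_unfold)
  also have "\<dots> = differences G B"
    unfolding differences_def
  proof (rule image_mset_cong)
    fix p assume "p \<in># mset_set (?P B)"
    then have "p \<in> ?P B"
      by (cases "finite (?P B)") simp_all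
    then have "fst p \<in> carrier G" "snd p \<in> carrier G"
      using assms by auto
    then show "(case p of (b, b') \<Rightarrow> inv b' \<otimes> inv (inv b)) = (case p of (b, b') \<Rightarrow> b \<otimes> inv b')"
      by (simp add: case_prod_unfold m_comm)
  qed
  finally show ?thesis .
qed

lemmas difference_family_defs =
  difference_family_def vkl_difference_family_def disjoint_vkl_difference_family_def

lemma disjoint_vkl_difference_family_subset:
  assumes "disjoint_vkl_difference_family G v k l F" "F' \<subseteq> F"
    and "\<And>g. g \<in> carrier G - {\<one>\<^bsub>G\<^esub>} \<Longrightarrow> count (\<Sum>B\<in>F'. differences G B) g = l'"
  shows "disjoint_vkl_difference_family G v k l' F'"
  using assms pairwise_subset by (auto simp: difference_family_defs)

lemma (in comm_group) disjoint_vkl_difference_family_split: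
  assumes finite_F: "finite F" and family: "disjoint_vkl_difference_family G v k l F"
    and closed: "\<And>B. B \<in> F \<Longrightarrow> m_inv G ` B \<in> F"
    and no_fixed_block: "\<And>B. B \<in> F \<Longrightarrow> m_inv G ` B \<noteq> B"
  obtains F1 F2 where "F2 = (`) (m_inv G) ` F1" "F1 \<union> F2 = F" "F1 \<inter> F2 = {}"
    "disjoint_vkl_difference_family G v k (l div 2) F1"
    "disjoint_vkl_difference_family G v k (l div 2) F2"
proof -
  have block_subset: "B \<subseteq> carrier G" if "B \<in> F" for B
    using family that
    by (auto simp: difference_family_defs)
  have invol: "m_inv G ` m_inv G ` B = B" if "B \<in> F" for B
    using block_subset[OF that] by (force simp: image_image)
  obtain F1 F2 where F2: "F2 = (`) (m_inv G) ` F1"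
    and union: "F1 \<union> F2 = F" and disjoint: "F1 \<inter> F2 = {}"
    using fixpoint_free_involution_split[of F "(`) (m_inv G)"] closed invol no_fixed_block by metis
  have family_subsets: "F1 \<subseteq> F" "F2 \<subseteq> F"
    using union by auto
  have "inj_on ((`) (m_inv G)) F1"
    using invol family_subsets(1) by (intro inj_on_inverseI[where g = "(`) (m_inv G)"]) blast
  then have sum_F2: "(\<Sum>B\<in>F2. differences G B) = (\<Sum>B\<in>F1. differences G B)"
    using block_subset family_subsets(1)
    by (auto simp: F2 sum.reindex differences_inv_image intro!: sum.cong)
  have "(\<Sum>B\<in>F. differences G B) = (\<Sum>B\<in>F1. differences G B) + (\<Sum>B\<in>F2. differences G B)"
    unfolding union[symmetric] using finite_F family_subsets disjoint
    by (intro sum.union_disjoint) (auto intro: finite_subset)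
  then have count_F1: "count (\<Sum>B\<in>F1. differences G B) g = l div 2" if "g \<in> carrier G - {\<one>}" for g
    using family that sum_F2
    by (auto simp: difference_family_defs)
  show thesis
  proof (rule that[OF F2 union disjoint])
    show "disjoint_vkl_difference_family G v k (l div 2) F1"
      using family family_subsets(1) count_F1 by (rule disjoint_vkl_difference_family_subset)
    show "disjoint_vkl_difference_family G v k (l div 2) F2"
      using family family_subsets(2)
      by (rule disjoint_vkl_difference_family_subset) (simp add: sum_F2 count_F1)
  qed
qed

locale finite_ferrero_pair = group G for G :: "('a, 'b) monoid_scheme" (structure) +
  fixes A :: "('a \<Rightarrow> 'a) set"
  assumes finite_carrier: "finite (carrier G)"
    and ferrero: "ferrero_pair G A"
begin

abbreviation acting_group :: "('a \<Rightarrow> 'a) monoid" where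
  "acting_group \<equiv> AutoGroup G\<lparr>carrier := A\<rparr>"

abbreviation orb :: "'a \<Rightarrow> 'a set" where
  "orb \<equiv> orbit acting_group (\<lambda>\<alpha>. \<alpha>)"

lemma subgroup_A: "subgroup A (AutoGroup G)"
  using ferrero by (simp add: ferrero_pair_def)

sublocale action: group_action acting_group "carrier G" "\<lambda>\<alpha>. \<alpha>"
  using subgroup_A by (rule group_action_subgroup_AutoGroup)

lemma one_in_A: "\<one>\<^bsub>AutoGroup G\<^esub> \<in> A"
  using subgroup_A by (rule subgroup.one_closed)

lemma one_A_apply: "x \<in> carrier G \<Longrightarrow> \<one>\<^bsub>AutoGroup G\<^esub> x = x"
  using fun_cong[OF action.id_eq_one, of x] by simp

lemma group_hom_A: "\<alpha> \<in> A \<Longrightarrow> group_hom G G \<alpha>"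
  using subgroup.subset[OF subgroup_A]
  by (auto simp: AutoGroup_def auto_def group_hom_def group_hom_axioms_def)

lemma finite_A: "finite A"
proof (rule finite_subset)
  show "A \<subseteq> carrier G \<rightarrow>\<^sub>E carrier G"
  proof
    fix \<alpha> assume "\<alpha> \<in> A"
    then have "\<alpha> \<in> Bij (carrier G)"
      using action.bij_prop0 by simp
    then show "\<alpha> \<in> carrier G \<rightarrow>\<^sub>E carrier G"
      by (simp add: PiE_def Bij_imp_extensional Bij_imp_funcset)
  qed
  show "finite (carrier G \<rightarrow>\<^sub>E carrier G)"
    using finite_carrier by (intro finite_PiE)
qed

lemma semiregular:
  "\<lbrakk>\<alpha> \<in> A; x \<in> carrier G - {\<one>}; \<alpha> x = x\<rbrakk> \<Longrightarrow> \<alpha> = \<one>\<^bsub>AutoGroup G\<^esub>"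
  using ferrero by (auto simp: ferrero_pair_def)

lemma stabilizer_eq_one:
  assumes "x \<in> carrier G - {\<one>}"
  shows "stabilizer acting_group (\<lambda>\<alpha>. \<alpha>) x = {\<one>\<^bsub>acting_group\<^esub>}"
  using assms semiregular[OF _ assms] action.stabilizer_one_closed[of x]
  by (auto simp: stabilizer_def)

lemma bij_betw_orb: "x \<in> carrier G - {\<one>} \<Longrightarrow> bij_betw (\<lambda>\<alpha>. \<alpha> x) A (orb x)"
  using action.bij_betw_orbit_trivial_stabilizer stabilizer_eq_one by simp

lemma nonzero_orbits_eq: "nonzero_orbits G A = orb ` (carrier G - {\<one>})"
  by (auto simp: nonzero_orbits_def orbits_def)

lemma partition_nonzero_orbits: "partition (carrier G - {\<one>}) (nonzero_orbits G A)"
  unfolding nonzero_orbits_def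
proof (rule action.partition_orbits_invariant_subset)
  fix x assume x: "x \<in> carrier G - {\<one>}"
  have "\<alpha> x \<in> carrier G - {\<one>}" if "\<alpha> \<in> A" for \<alpha>
  proof -
    interpret \<alpha>: group_hom G G \<alpha>
      using that by (rule group_hom_A)
    show ?thesis
      using x that action.inj_prop[of \<alpha>] by (auto dest: inj_onD[of _ _ x \<one>])
  qed
  then show "orb x \<subseteq> carrier G - {\<one>}"
    by (auto simp: orbit_eq_image)
qed blast

lemma nonzero_orbit_eq_orb:
  assumes "B \<in> nonzero_orbits G A" "x \<in> B"
  shows "x \<in> carrier G - {\<one>}" "B = orb x"
proof -
  show x: "x \<in> carrier G - {\<one>}"
    using partition.incl[OF partition_nonzero_orbits] assms by blast
  then have "orb x \<in> nonzero_orbits G A" "x \<in> orb x"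
    using action.orbit_refl by (auto simp: nonzero_orbits_eq)
  then show "B = orb x"
    using partition.disjoint_union[OF partition_nonzero_orbits] assms by blast
qed

lemma finite_nonzero_orbits: "finite (nonzero_orbits G A)"
  by (simp add: nonzero_orbits_eq finite_carrier)

lemma nonzero_orbits_nonempty: "nonzero_orbits G A \<noteq> {}"
proof -
  obtain \<alpha> where \<alpha>: "\<alpha> \<in> A" "\<alpha> \<noteq> \<one>\<^bsub>AutoGroup G\<^esub>"
    using ferrero one_in_A by (auto simp: ferrero_pair_def)
  interpret \<alpha>: group_hom G G \<alpha>
    using \<alpha>(1) by (rule group_hom_A)
  have "\<alpha> \<in> extensional (carrier G)"
    using action.bij_prop0[of \<alpha>] \<alpha>(1) by (simp add: Bij_def)
  moreover have "\<alpha> \<noteq> (\<lambda>x\<in>carrier G. x)"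
    using \<alpha>(2) action.id_eq_one by simp
  ultimately obtain x where x: "x \<in> carrier G" "\<alpha> x \<noteq> x"
    using extensionalityI[OF _ restrict_extensional, of \<alpha> "carrier G" "\<lambda>x. x"] by auto
  then have "x \<noteq> \<one>"
    using \<alpha>.hom_one by metis
  then show ?thesis
    using x(1) by (auto simp: nonzero_orbits_eq)
qed

lemma card_nonzero_orbit:
  assumes "B \<in> nonzero_orbits G A"
  shows "card B = card A"
proof -
  obtain x where "x \<in> carrier G - {\<one>}" "B = orb x"
    using assms by (auto simp: nonzero_orbits_eq)
  then show ?thesis
    using bij_betw_same_card[OF bij_betw_orb] by simp
qed

lemma differences_nonzero_orbit:
  assumes B: "B \<in> nonzero_orbits G A"
  shows "differences G B = (\<Sum>x\<in>B. \<Sum>\<alpha>\<in>A - {\<one>\<^bsub>AutoGroup G\<^esub>}. {#\<alpha> x \<otimes> inv x#})"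
proof -
  have "(\<Sum>b\<in>B - {x}. {#b \<otimes> inv x#}) = (\<Sum>\<alpha>\<in>A - {\<one>\<^bsub>AutoGroup G\<^esub>}. {#\<alpha> x \<otimes> inv x#})"
    if "x \<in> B" for x
  proof -
    note x = nonzero_orbit_eq_orb[OF B that]
    have "\<one>\<^bsub>AutoGroup G\<^esub> x = x"
      using one_A_apply x(1) by simp
    then have "bij_betw (\<lambda>\<alpha>. \<alpha> x) (A - {\<one>\<^bsub>AutoGroup G\<^esub>}) (B - {x})"
      using bij_betw_DiffI[OF bij_betw_orb[OF x(1)], of "{\<one>\<^bsub>AutoGroup G\<^esub>}" "{x}"] one_in_A x(2) that
      by simp
    then show ?thesis
      by (rule sum.reindex_bij_betw[symmetric])
  qed
  moreover have "finite B"
    using partition.incl[OF partition_nonzero_orbits B] finite_carrier finite_subset by blast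
  ultimately show ?thesis
    by (simp add: differences_eq_sum)
qed

lemma sum_differences_nonzero_orbits:
  "(\<Sum>B\<in>nonzero_orbits G A. differences G B)
    = repeat_mset (card A - 1) (mset_set (carrier G - {\<one>}))"
proof -
  let ?A = "A - {\<one>\<^bsub>AutoGroup G\<^esub>}"
  have "(\<Sum>B\<in>nonzero_orbits G A. differences G B)
      = (\<Sum>B\<in>nonzero_orbits G A. \<Sum>x\<in>B. \<Sum>\<alpha>\<in>?A. {#\<alpha> x \<otimes> inv x#})"
    by (simp add: differences_nonzero_orbit)
  also have "\<dots> = (\<Sum>x\<in>carrier G - {\<one>}. \<Sum>\<alpha>\<in>?A. {#\<alpha> x \<otimes> inv x#})"
    using partition.disjoint_sum[OF partition_nonzero_orbits] finite_carrier by blast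
  also have "\<dots> = (\<Sum>\<alpha>\<in>?A. \<Sum>x\<in>carrier G - {\<one>}. {#\<alpha> x \<otimes> inv x#})"
    by (rule sum.swap)
  also have "\<dots> = (\<Sum>\<alpha>\<in>?A. mset_set (carrier G - {\<one>}))"
  proof (rule sum.cong)
    fix \<alpha> assume \<alpha>: "\<alpha> \<in> ?A"
    then have "bij_betw (\<lambda>x. \<alpha> x \<otimes> inv x) (carrier G - {\<one>}) (carrier G - {\<one>})"
      using semiregular group_hom_A finite_carrier
      by (intro bij_betw_displacement) (auto intro: group_hom.homh)
    from sum.reindex_bij_betw[OF this, of "\<lambda>y. {#y#}"]
    show "(\<Sum>x\<in>carrier G - {\<one>}. {#\<alpha> x \<otimes> inv x#}) = mset_set (carrier G - {\<one>})"
      by simp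
  qed simp
  also have "\<dots> = repeat_mset (card A - 1) (mset_set (carrier G - {\<one>}))"
    using finite_A one_in_A by (intro multiset_eqI) (simp add: count_sum)
  finally show ?thesis .
qed

lemma disjoint_difference_family_nonzero_orbits:
  "disjoint_vkl_difference_family G (order G) (card A) (card A - 1) (nonzero_orbits G A)"
proof -
  have "count (\<Sum>B\<in>nonzero_orbits G A. differences G B) g = card A - 1"
    if "g \<in> carrier G - {\<one>}" for g
    using that finite_carrier by (simp add: sum_differences_nonzero_orbits)
  moreover have "disjoint (nonzero_orbits G A)"
    using partition.disjoint_union[OF partition_nonzero_orbits] by (meson disjointI)
  moreover have "nonzero_orbits G A \<subseteq> Pow (carrier G)"
    using partition.incl[OF partition_nonzero_orbits] by blast
  ultimately show ?thesis
    using card_nonzero_orbit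
    by (simp add: difference_family_defs)
qed

lemma inv_image_nonzero_orbit:
  assumes "B \<in> nonzero_orbits G A"
  shows "m_inv G ` B \<in> nonzero_orbits G A"
proof -
  obtain x where x: "x \<in> carrier G - {\<one>}" "B = orb x"
    using assms by (auto simp: nonzero_orbits_eq)
  have "m_inv G ` B = orb (inv x)"
    using x group_hom.hom_inv[OF group_hom_A] by (auto simp: orbit_eq_image image_image)
  moreover have "inv x \<in> carrier G - {\<one>}"
    using x(1) by auto
  ultimately show ?thesis
    by (simp add: nonzero_orbits_eq)
qed

lemma inv_image_nonzero_orbit_neq:
  assumes odd: "odd (order G)" "odd (card A)" and B: "B \<in> nonzero_orbits G A"
  shows "m_inv G ` B \<noteq> B"
proof
  assume eq: "m_inv G ` B = B"
  obtain x where x: "x \<in> carrier G - {\<one>}" "B = orb x"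
    using B by (auto simp: nonzero_orbits_eq)
  then have "inv x \<in> orb x"
    using eq action.orbit_refl[of x] by blast
  then obtain \<alpha> where \<alpha>: "\<alpha> \<in> A" "\<alpha> x = inv x"
    by (auto simp: orbit_eq_image)
  interpret acting: group acting_group
    using action.group_hom by (rule group_hom.axioms)
  have "(\<alpha> \<otimes>\<^bsub>acting_group\<^esub> \<alpha>) x = \<alpha> (inv x)"
    using action.composition_rule[of x \<alpha> \<alpha>] \<alpha> x(1) by simp
  also have "\<dots> = x"
    using group_hom.hom_inv[OF group_hom_A[OF \<alpha>(1)], of x] \<alpha>(2) x(1) by simp
  finally have "\<alpha> \<otimes>\<^bsub>acting_group\<^esub> \<alpha> = \<one>\<^bsub>acting_group\<^esub>"
    using semiregular[of "\<alpha> \<otimes>\<^bsub>acting_group\<^esub> \<alpha>" x] acting.m_closed[of \<alpha> \<alpha>] \<alpha>(1) x(1) by simp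
  then have "\<alpha> = \<one>\<^bsub>acting_group\<^esub>"
    using acting.square_eq_one_odd_order[of \<alpha>] \<alpha>(1) odd(2) by (simp add: order_def)
  then have "inv x = x"
    using \<alpha>(2) x(1) one_A_apply by simp
  then have "x \<otimes> x = \<one>"
    using x(1) r_inv[of x] by simp
  then show False
    using square_eq_one_odd_order[of x] x(1) odd(1) by simp
qed

end

theorem theorem1:
  fixes G :: "('a, 'b) monoid_scheme" and A :: "('a \<Rightarrow> 'a) set" and v k :: nat
  assumes "group G" and "finite (carrier G)" and "order G = v"
    and "ferrero_pair G A" and "card A = k"
  shows "disjoint_vkl_difference_family G v k (k - 1) (nonzero_orbits G A) \<and>
    (comm_group G \<and> odd (v * k) \<longrightarrow>
      (\<exists>F1 F2. F1 \<noteq> {} \<and> F2 \<noteq> {} \<and>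
        F1 \<union> F2 = nonzero_orbits G A \<and> F1 \<inter> F2 = {} \<and>
        disjoint_vkl_difference_family G v k ((k - 1) div 2) F1 \<and>
        disjoint_vkl_difference_family G v k ((k - 1) div 2) F2))"
proof (intro conjI impI)
  interpret finite_ferrero_pair G A
    using assms by (simp add: finite_ferrero_pair.intro finite_ferrero_pair_axioms.intro)
  show family: "disjoint_vkl_difference_family G v k (k - 1) (nonzero_orbits G A)"
    using disjoint_difference_family_nonzero_orbits assms(3,5) by simp
  assume comm_odd: "comm_group G \<and> odd (v * k)"
  then interpret comm_group G
    by blast
  have odd: "odd (order G)" "odd (card A)"
    using comm_odd assms(3,5) by auto
  obtain F1 F2 where F2: "F2 = (`) (m_inv G) ` F1"
    and partition: "F1 \<union> F2 = nonzero_orbits G A" "F1 \<inter> F2 = {}"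
    and families: "disjoint_vkl_difference_family G v k ((k - 1) div 2) F1"
      "disjoint_vkl_difference_family G v k ((k - 1) div 2) F2"
    by (rule disjoint_vkl_difference_family_split[OF finite_nonzero_orbits family
          inv_image_nonzero_orbit inv_image_nonzero_orbit_neq[OF odd]])
  have "F1 \<noteq> {}" "F2 \<noteq> {}"
    using F2 partition(1) nonzero_orbits_nonempty by auto
  then show "\<exists>F1 F2. F1 \<noteq> {} \<and> F2 \<noteq> {} \<and>
      F1 \<union> F2 = nonzero_orbits G A \<and> F1 \<inter> F2 = {} \<and>
      disjoint_vkl_difference_family G v k ((k - 1) div 2) F1 \<and>
      disjoint_vkl_difference_family G v k ((k - 1) div 2) F2"
    using partition families by (intro exI[of _ F1] exI[of _ F2] conjI)
qed

end
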